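(* Let $K(a_{n,k})$ be a Köthe space and $\Lambda_1(\beta)$ a power series space of finite type. Assume there exists a non-decreasing function $S:\mathbb{N}\to\mathbb{N}$ such that $$\forall k\in\mathbb{N}\ \exists C>0\ \ \forall n\in\mathbb{N}:\quad e^{-\frac1k\beta_n}\le C a_{n,S(k)}.$$ Then the family of operators $\hat T_\theta:K(a_{n,k})\to\Lambda_1(\beta)$ for $\theta\in\Lambda_1(\beta)$, that is, $\hat{\mathcal A}_1=\{\hat T_\theta:\theta\in\Lambda_1(\beta)\}$, is $\tilde S$-tame, where $\tilde S(k)=S(2k)$ for every $k\in\mathbb{N}$.
   Context: $\mathbb{N}=\{1,2,3,\dots\}$. A Köthe matrix is a matrix $(a_{n,k})_{n,k\in\mathbb{N}}$ of non-negative numbers such that for each $n$ there is $k$ with $a_{n,k}>0$, and $a_{n,k}\le a_{n,k+1}$ for all $n,k$. The Köthe space is $K(a_{n,k})=\{x=(x_n)_{n\in\mathbb{N}}:\|x\|_k:=\sum_n|x_n|a_{n,k}<\infty\ \forall k\in\mathbb{N}\}$, a Fréchet space graded by the seminorms $\|\cdot\|_k$. For $\beta=(\beta_n)_{n\in\mathbb{N}}$ non-negative, increasing, with $\beta_n\to\infty$, the power series space of finite type $\Lambda_1(\beta)$ is the Köthe space with matrix $(e^{-\frac1k\beta_n})_{n,k}$. $e_n$ is the sequence with $1$ in the $n$-th place and $0$ elsewhere. For a sequence $\theta=(\theta_0,\theta_1,\theta_2,\dots)$ (regarded as an element of a sequence space indexed by $\mathbb{N}$ by letting its $n$-th coordinate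 be $\theta_{n-1}$), the operator $\hat T_\theta$ given by the lower triangular Toeplitz matrix of $\theta$ is $\hat T_\theta e_n=\sum_{j=n}^\infty\theta_{j-n}e_j$, $\hat T_\theta x=\sum_n x_n\hat T_\theta e_n$ for $x=\sum_n x_ne_n$. Standing assumption: all symbol sequences $\theta$ considered satisfy $\theta_t\ne0$ for infinitely many $t$. $S$-tameness: let $E,F$ be Fréchet spaces graded by increasing seminorms $(\|\cdot\|_k)_{k\in\mathbb{N}}$ and $S:\mathbb{N}\to\mathbb{N}$ non-decreasing. A family $\mathcal A\subseteq L(E,F)$ of continuous linear operators is $S$-tame if for every $T\in\mathcal A$ there exist $k_0\in\mathbb{N}$ and $C>0$ such that $\|Tx\|_k\le C\|x\|_{S(k)}$ for all $x\in E$ and all $k\ge k_0$.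
   Formalization: In the definition of S-tameness the constant C may depend on k (there is k_0 such that for every k ≥ k_0 there is C>0 with the bound for all x); with one C for all k ≥ k_0 the claim fails, e.g. β_n=n, a_{n,k}=e^{-n/k}, S=id, θ_t=1. *)

theory Defs
  imports "HOL-Analysis.Analysis" "HOL-Library.Function_Algebras"
begin

text \<open>
  Conventions. The index set is \<open>{1, 2, 3, ...}\<close>, rendered as \<open>{1..} :: nat set\<close>; values of matrices,
  weights and of \<open>S\<close> at index 0 are never used. The scalars are an arbitrary complete normed field
  over the reals, which covers both the real and the complex case.
\<close>

text \<open>
  A vector space over \<open>'k\<close> with carrier \<open>vecs\<close> and seminorms \<open>snorm k\<close>, \<open>k \<ge> 1\<close>; addition is the one of
  the ambient type. The record carries only the data; the notions below are meant for graded
  Frechet spaces, but their definitions do not involve completeness.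
\<close>

record ('k, 'v) graded_space =
  vecs :: "'v set"
  smult :: "'k \<Rightarrow> 'v \<Rightarrow> 'v"
  snorm :: "nat \<Rightarrow> 'v \<Rightarrow> real"

definition graded_topology :: "('k, 'v::ab_group_add) graded_space \<Rightarrow> 'v topology" where
  "graded_topology E = topology_generated_by
     {{y \<in> vecs E. snorm E k (y - x) < \<epsilon>} | x k \<epsilon>. x \<in> vecs E \<and> 1 \<le> k \<and> 0 < \<epsilon>}"

text \<open>
  \<open>L(E,F)\<close>. An operator on \<open>E\<close> is a function on the ambient type of which only the values
  on \<open>vecs E\<close> matter.
\<close>

definition continuous_linear_operators ::
  "('k, 'v::ab_group_add) graded_space \<Rightarrow> ('k, 'w::ab_group_add) graded_space \<Rightarrow> ('v \<Rightarrow> 'w) set" where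
  "continuous_linear_operators E F =
     {T. T ` vecs E \<subseteq> vecs F \<and>
         (\<forall>x\<in>vecs E. \<forall>y\<in>vecs E. T (x + y) = T x + T y) \<and>
         (\<forall>c. \<forall>x\<in>vecs E. T (smult E c x) = smult F c (T x)) \<and>
         continuous_map (graded_topology E) (graded_topology F) T}"

definition nondecreasing_index_map :: "(nat \<Rightarrow> nat) \<Rightarrow> bool" where
  "nondecreasing_index_map S \<longleftrightarrow> S ` {1..} \<subseteq> {1..} \<and> mono_on {1..} S"

text \<open>
  The constant may depend on \<open>k\<close>, as is usual for tameness. With one \<open>C\<close> for all \<open>k \<ge> k0\<close> the
  Toeplitz family below would not be tame: for \<open>\<beta> n = n\<close>, \<open>a n k = exp (- n / k)\<close>, \<open>S k = k\<close> and
  \<open>\<theta> t = 1\<close>, the \<open>k\<close>-norm of the image of \<open>e_1\<close> is the sum of \<open>exp (- j / k)\<close> over \<open>j \<ge> 1\<close>, which is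
  unbounded in \<open>k\<close>, while all norms of \<open>e_1\<close> are at most 1.
\<close>

definition tame_family ::
  "(nat \<Rightarrow> nat) \<Rightarrow> ('k, 'v::ab_group_add) graded_space \<Rightarrow> ('k, 'w::ab_group_add) graded_space \<Rightarrow>
   ('v \<Rightarrow> 'w) set \<Rightarrow> bool" where
  "tame_family S E F A \<longleftrightarrow>
     nondecreasing_index_map S \<and> A \<subseteq> continuous_linear_operators E F \<and>
     (\<forall>T\<in>A. \<exists>k0\<ge>1. \<forall>k\<ge>k0. \<exists>C>0. \<forall>x\<in>vecs E. snorm F k (T x) \<le> C * snorm E (S k) x)"

definition koethe_matrix :: "(nat \<Rightarrow> nat \<Rightarrow> real) \<Rightarrow> bool" where
  "koethe_matrix a \<longleftrightarrow>
     (\<forall>n\<ge>1. \<forall>k\<ge>1. 0 \<le> a n k) \<and>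
     (\<forall>n\<ge>1. \<exists>k\<ge>1. 0 < a n k) \<and>
     (\<forall>n\<ge>1. \<forall>k\<ge>1. a n k \<le> a n (k + 1))"

text \<open>
  A sequence \<open>(x n)\<close>, \<open>n \<ge> 1\<close>, is represented by the function on \<open>nat\<close> that is extended by \<open>x 0 = 0\<close>.
\<close>

definition koethe_space ::
  "(nat \<Rightarrow> nat \<Rightarrow> real) \<Rightarrow> ('k::{real_normed_field,banach}, nat \<Rightarrow> 'k) graded_space" where
  "koethe_space a =
     \<lparr>vecs = {x. x 0 = 0 \<and> (\<forall>k\<ge>1. (\<lambda>n. norm (x n) * a n k) summable_on {1..})},
      smult = (\<lambda>c x n. c * x n),
      snorm = (\<lambda>k x. \<Sum>\<^sub>\<infinity>n\<in>{1..}. norm (x n) * a n k)\<rparr>"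

definition finite_type_weight :: "(nat \<Rightarrow> real) \<Rightarrow> bool" where
  "finite_type_weight \<beta> \<longleftrightarrow>
     (\<forall>n\<ge>1. 0 \<le> \<beta> n) \<and> mono_on {1..} \<beta> \<and> filterlim \<beta> at_top sequentially"

definition power_series_space_finite ::
  "(nat \<Rightarrow> real) \<Rightarrow> ('k::{real_normed_field,banach}, nat \<Rightarrow> 'k) graded_space" where
  "power_series_space_finite \<beta> = koethe_space (\<lambda>n k. exp (- (1 / real k) * \<beta> n))"

definition unit_seq :: "nat \<Rightarrow> nat \<Rightarrow> 'k::zero_neq_one" where
  "unit_seq n = (\<lambda>j. if j = n then 1 else 0)"

text \<open>
  A symbol \<open>\<theta>\<close> is indexed from 0; as an element of a sequence space its n-th coordinate
  is \<open>\<theta> (n - 1)\<close>.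
\<close>

definition symbol_seq :: "(nat \<Rightarrow> 'k::zero) \<Rightarrow> nat \<Rightarrow> 'k" where
  "symbol_seq \<theta> = (\<lambda>n. if n = 0 then 0 else \<theta> (n - 1))"

text \<open>Sum of the series of \<open>f j\<close>, \<open>j \<ge> m\<close>, in the topology of \<open>F\<close>.\<close>

definition graded_series ::
  "('k, 'v::ab_group_add) graded_space \<Rightarrow> nat \<Rightarrow> (nat \<Rightarrow> 'v) \<Rightarrow> 'v" where
  "graded_series F m f =
     (THE y. limitin (graded_topology F) (\<lambda>N. \<Sum>j=m..N. f j) y sequentially)"

definition toeplitz_column ::
  "('k::{real_normed_field,banach}, nat \<Rightarrow> 'k) graded_space \<Rightarrow> (nat \<Rightarrow> 'k) \<Rightarrow> nat \<Rightarrow> nat \<Rightarrow> 'k" where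
  "toeplitz_column F \<theta> n = graded_series F n (\<lambda>j. smult F (\<theta> (j - n)) (unit_seq j))"

text \<open>
  The lower triangular Toeplitz operator with values in the sequence space \<open>F\<close>. Both series are
  limits in \<open>F\<close>, so membership of this operator in \<open>L(E,F)\<close> includes their convergence on \<open>E\<close>.
\<close>

definition toeplitz_operator ::
  "('k::{real_normed_field,banach}, nat \<Rightarrow> 'k) graded_space \<Rightarrow> (nat \<Rightarrow> 'k) \<Rightarrow> (nat \<Rightarrow> 'k) \<Rightarrow> nat \<Rightarrow> 'k" where
  "toeplitz_operator F \<theta> x = graded_series F 1 (\<lambda>n. smult F (x n) (toeplitz_column F \<theta> n))"

text \<open>The nonvanishing condition is the standing assumption on symbols.\<close>

definition toeplitz_family ::
  "(nat \<Rightarrow> real) \<Rightarrow> ((nat \<Rightarrow> 'k::{real_normed_field,banach}) \<Rightarrow> nat \<Rightarrow> 'k) set" where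
  "toeplitz_family \<beta> =
     {toeplitz_operator (power_series_space_finite \<beta>) \<theta> | \<theta>.
        symbol_seq \<theta> \<in> vecs (power_series_space_finite \<beta>) \<and> infinite {t. \<theta> t \<noteq> 0}}"

end

theory Submission
  imports Defs
begin

text \<open>
  Since \<open>\<beta>\<close> increases, an index \<open>j \<ge> n\<close> satisfies both \<open>\<beta> n \<le> \<beta> j\<close> and \<open>\<beta> (j - n + 1) \<le> \<beta> j\<close>.
  Giving half of the exponent \<open>\<beta> j / k\<close> to each of the two bounds yields
  \<open>exp (- \<beta> j / k) \<le> exp (- \<beta> (j - n + 1) / (2 k)) * exp (- \<beta> n / (2 k))\<close>
  (\<open>finite_type_weight_split\<close>). The entry of the \<open>n\<close>-th Toeplitz column at \<open>j\<close> is \<open>\<theta> (j - n)\<close>,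
  which is the coordinate \<open>j - n + 1\<close> of the symbol. Summing over \<open>j\<close> therefore bounds the \<open>k\<close>-norm
  of this column by the \<open>2 k\<close>-norm of the symbol times the weight \<open>exp (- \<beta> n / (2 k))\<close>
  (\<open>toeplitz_column_finite_type\<close>), and by hypothesis that weight is at most a constant times
  \<open>a n (S (2 k))\<close>. Multiplying by \<open>x n\<close> and summing over \<open>n\<close> gives the tameness estimate with
  \<open>S (2 k)\<close>, for every \<open>k \<ge> 1\<close>.

  The estimate also has to justify the two series by which the operator is defined, because both are
  limits in the topology of the power series space. In a Koethe space a series that converges
  absolutely in every seminorm converges to its coordinatewise sum
  (\<open>koethe_absolutely_convergent_series\<close>): by Tonelli the coordinatewise sum lies in the space and
  its seminorm is at most the sum of the seminorms, and the same bound applied to the tails is the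
  convergence. Hence the operator is the coordinatewise convolution
  \<open>(T x) i = \<Sum>n=1..i. x n * \<theta> (i - n)\<close>, from which linearity is read off, and continuity follows
  from the seminorm estimates.
\<close>

section \<open>Graded seminormed groups\<close>

text \<open>
  The additive facts about seminorms by which the balls generate a topology with the expected
  limits. The triangle inequality is stated for differences, the form in which balls use it.
\<close>

locale graded_seminormed_group =
  fixes E :: "('k, 'v::ab_group_add) graded_space"
  assumes diff_mem: "x \<in> vecs E \<Longrightarrow> y \<in> vecs E \<Longrightarrow> x - y \<in> vecs E"
    and zero_mem: "0 \<in> vecs E"
    and snorm_zero: "1 \<le> k \<Longrightarrow> snorm E k 0 = 0"
    and snorm_triangle_diff:
      "1 \<le> k \<Longrightarrow> x \<in> vecs E \<Longrightarrow> y \<in> vecs E \<Longrightarrow> z \<in> vecs E \<Longrightarrow>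
        snorm E k (x - z) \<le> snorm E k (x - y) + snorm E k (y - z)"
    and snorm_nonneg: "1 \<le> k \<Longrightarrow> x \<in> vecs E \<Longrightarrow> 0 \<le> snorm E k x"
    and snorm_minus_commute: "snorm E k (x - y) = snorm E k (y - x)"
begin

lemma add_mem: "x \<in> vecs E \<Longrightarrow> y \<in> vecs E \<Longrightarrow> x + y \<in> vecs E"
  using diff_mem[of x "0 - y"] diff_mem[OF zero_mem, of y] by simp

lemma sum_mem: "(\<And>i. i \<in> I \<Longrightarrow> f i \<in> vecs E) \<Longrightarrow> sum f I \<in> vecs E"
  by (induction I rule: infinite_finite_induct) (auto simp: zero_mem add_mem)

definition ball_at :: "nat \<Rightarrow> 'v \<Rightarrow> real \<Rightarrow> 'v set" where
  "ball_at k x \<epsilon> = {y \<in> vecs E. snorm E k (y - x) < \<epsilon>}"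

lemma graded_topology_balls:
  "graded_topology E =
     topology_generated_by {ball_at k x \<epsilon> | x k \<epsilon>. x \<in> vecs E \<and> 1 \<le> k \<and> 0 < \<epsilon>}"
  by (simp add: graded_topology_def ball_at_def)

lemma center_in_ball: "x \<in> vecs E \<Longrightarrow> 1 \<le> k \<Longrightarrow> 0 < \<epsilon> \<Longrightarrow> x \<in> ball_at k x \<epsilon>"
  by (simp add: ball_at_def snorm_zero)

lemma union_balls: "\<Union>{ball_at k x \<epsilon> | x k \<epsilon>. x \<in> vecs E \<and> 1 \<le> k \<and> 0 < \<epsilon>} = vecs E"
proof
  show "vecs E \<subseteq> \<Union>{ball_at k x \<epsilon> | x k \<epsilon>. x \<in> vecs E \<and> 1 \<le> k \<and> 0 < \<epsilon>}"
  proof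
    fix x assume x: "x \<in> vecs E"
    then have "x \<in> ball_at 1 x 1" by (simp add: center_in_ball)
    with x show "x \<in> \<Union>{ball_at k x \<epsilon> | x k \<epsilon>. x \<in> vecs E \<and> 1 \<le> k \<and> 0 < \<epsilon>}"
      by (intro UnionI[of "ball_at 1 x 1"]) (auto intro!: exI[of _ x] exI[of _ "1::nat"] exI[of _ "1::real"])
  qed
qed (auto simp: ball_at_def)

lemma topspace_graded_topology: "topspace (graded_topology E) = vecs E"
  unfolding graded_topology_balls topology_generated_by_topspace by (rule union_balls)

lemma openin_ball:
  assumes "x \<in> vecs E" "1 \<le> k" "0 < \<epsilon>"
  shows "openin (graded_topology E) (ball_at k x \<epsilon>)"
  unfolding graded_topology_balls using assms by (intro topology_generated_by_Basis) blast

text \<open>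
  The topology is only given by a subbase, and every ball containing \<open>y\<close> contains a
  smaller ball centred at \<open>y\<close>; eventual membership then passes to finite intersections and unions.
\<close>

lemma limitin_graded_topology_iff:
  assumes f: "\<And>N. f N \<in> vecs E"
  shows "limitin (graded_topology E) f y sequentially \<longleftrightarrow>
    y \<in> vecs E \<and> (\<forall>k\<ge>1. (\<lambda>N. snorm E k (f N - y)) \<longlonglongrightarrow> 0)"
proof
  assume lim: "limitin (graded_topology E) f y sequentially"
  then have y: "y \<in> vecs E"
    using limitin_topspace[OF lim] by (simp add: topspace_graded_topology)
  moreover have "(\<lambda>N. snorm E k (f N - y)) \<longlonglongrightarrow> 0" if k: "1 \<le> k" for k
  proof (rule tendstoI)
    fix \<epsilon> :: real assume \<epsilon>: "0 < \<epsilon>"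
    have "\<forall>\<^sub>F N in sequentially. f N \<in> ball_at k y \<epsilon>"
      using lim openin_ball[OF y k \<epsilon>] center_in_ball[OF y k \<epsilon>] by (auto simp: limitin_def)
    then show "\<forall>\<^sub>F N in sequentially. dist (snorm E k (f N - y)) 0 < \<epsilon>"
      by eventually_elim (use snorm_nonneg[OF k diff_mem[OF f y]] in \<open>simp add: ball_at_def\<close>)
  qed
  ultimately show "y \<in> vecs E \<and> (\<forall>k\<ge>1. (\<lambda>N. snorm E k (f N - y)) \<longlonglongrightarrow> 0)" by blast
next
  assume R: "y \<in> vecs E \<and> (\<forall>k\<ge>1. (\<lambda>N. snorm E k (f N - y)) \<longlonglongrightarrow> 0)"
  have "\<forall>\<^sub>F N in sequentially. f N \<in> U"
    if "generate_topology_on {ball_at k x \<epsilon> | x k \<epsilon>. x \<in> vecs E \<and> 1 \<le> k \<and> 0 < \<epsilon>} U" "y \<in> U" for U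
    using that
  proof induction
    case Empty
    then show ?case by simp
  next
    case (Int a b)
    then show ?case by (auto intro: eventually_conj)
  next
    case (UN K)
    then obtain V where V: "V \<in> K" "y \<in> V" by blast
    then have "\<forall>\<^sub>F N in sequentially. f N \<in> V" using UN.IH by blast
    then show ?case by (rule eventually_mono) (use V in blast)
  next
    case (Basis s)
    then obtain x k \<epsilon> where s: "s = ball_at k x \<epsilon>" "x \<in> vecs E" "1 \<le> k" "0 < \<epsilon>" by blast
    have "snorm E k (y - x) < \<epsilon>" using Basis.prems s by (simp add: ball_at_def)
    then have "\<forall>\<^sub>F N in sequentially. snorm E k (f N - y) < \<epsilon> - snorm E k (y - x)"
      using R s(3) order_tendstoD(2)[of _ 0 sequentially "\<epsilon> - snorm E k (y - x)"] by simp
    then show ?case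
    proof eventually_elim
      case (elim N)
      then show ?case
        using snorm_triangle_diff[of k "f N" y x] R f s by (simp add: ball_at_def)
    qed
  qed
  then show "limitin (graded_topology E) f y sequentially"
    using R unfolding limitin_def topspace_graded_topology
    by (simp add: graded_topology_balls openin_topology_generated_by_iff)
qed

text \<open>
  The sum of a series is a definite description, so the seminorms must separate points for it to
  denote the limit.
\<close>

lemma graded_series_eqI:
  assumes separating: "\<And>x. x \<in> vecs E \<Longrightarrow> (\<And>k. 1 \<le> k \<Longrightarrow> snorm E k x = 0) \<Longrightarrow> x = 0"
    and f: "\<And>n. m \<le> n \<Longrightarrow> f n \<in> vecs E"
    and y: "y \<in> vecs E"
    and lim: "\<And>k. 1 \<le> k \<Longrightarrow> (\<lambda>N. snorm E k ((\<Sum>j=m..N. f j) - y)) \<longlonglongrightarrow> 0"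
  shows "graded_series E m f = y"
proof -
  have P: "(\<Sum>j=m..N. f j) \<in> vecs E" for N using f by (intro sum_mem) simp
  show ?thesis
    unfolding graded_series_def limitin_graded_topology_iff[of "\<lambda>N. \<Sum>j=m..N. f j", OF P]
  proof (rule the_equality)
    show "y \<in> vecs E \<and> (\<forall>k\<ge>1. (\<lambda>N. snorm E k ((\<Sum>j=m..N. f j) - y)) \<longlonglongrightarrow> 0)"
      using y lim by blast
  next
    fix z assume z: "z \<in> vecs E \<and> (\<forall>k\<ge>1. (\<lambda>N. snorm E k ((\<Sum>j=m..N. f j) - z)) \<longlonglongrightarrow> 0)"
    have "snorm E k (z - y) = 0" if k: "1 \<le> k" for k
    proof -
      have "snorm E k (z - y) \<le> 0"
      proof (rule tendsto_lowerbound)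
        show "(\<lambda>N. snorm E k ((\<Sum>j=m..N. f j) - z) + snorm E k ((\<Sum>j=m..N. f j) - y)) \<longlonglongrightarrow> 0"
          using tendsto_add[OF conjunct2[OF z, rule_format, OF k] lim[OF k]] by simp
        show "\<forall>\<^sub>F N in sequentially. snorm E k (z - y) \<le>
            snorm E k ((\<Sum>j=m..N. f j) - z) + snorm E k ((\<Sum>j=m..N. f j) - y)"
          using snorm_triangle_diff[OF k conjunct1[OF z] P y]
          by (intro always_eventually allI) (simp add: snorm_minus_commute[of k z])
      qed simp
      then show ?thesis using snorm_nonneg[OF k diff_mem, of z y] z y by simp
    qed
    then show "z = y" using separating[of "z - y"] diff_mem z y by simp
  qed
qed

end

lemma continuous_map_graded_topologyI:
  assumes E: "graded_seminormed_group E" and F: "graded_seminormed_group F"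
    and maps: "T ` vecs E \<subseteq> vecs F"
    and diff: "\<And>x y. x \<in> vecs E \<Longrightarrow> y \<in> vecs E \<Longrightarrow> T (x - y) = T x - T y"
    and bound: "\<And>k. 1 \<le> k \<Longrightarrow> \<exists>l\<ge>1. \<exists>C>0. \<forall>x\<in>vecs E. snorm F k (T x) \<le> C * snorm E l x"
  shows "continuous_map (graded_topology E) (graded_topology F) T"
proof -
  interpret E: graded_seminormed_group E by fact
  interpret F: graded_seminormed_group F by fact
  show ?thesis
    unfolding F.graded_topology_balls
  proof (rule continuous_on_generated_topo)
    fix U assume "U \<in> {F.ball_at k x \<epsilon> | x k \<epsilon>. x \<in> vecs F \<and> 1 \<le> k \<and> 0 < \<epsilon>}"
    then obtain k v \<epsilon> where U: "U = F.ball_at k v \<epsilon>" "v \<in> vecs F" "1 \<le> k" "0 < \<epsilon>" by blast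
    obtain l C where l: "1 \<le> l" and C: "0 < C"
      and le: "\<And>x. x \<in> vecs E \<Longrightarrow> snorm F k (T x) \<le> C * snorm E l x"
      using bound[OF U(3)] by blast
    show "openin (graded_topology E) (T -` U \<inter> topspace (graded_topology E))"
    proof (subst openin_subopen, intro ballI)
      fix u assume "u \<in> T -` U \<inter> topspace (graded_topology E)"
      then have u: "u \<in> vecs E" and Tu: "snorm F k (T u - v) < \<epsilon>"
        by (auto simp: U F.ball_at_def E.topspace_graded_topology)
      define \<delta> where "\<delta> = (\<epsilon> - snorm F k (T u - v)) / C"
      have \<delta>: "0 < \<delta>" using Tu C by (simp add: \<delta>_def)
      have "E.ball_at l u \<delta> \<subseteq> T -` U \<inter> topspace (graded_topology E)"
      proof
        fix w assume "w \<in> E.ball_at l u \<delta>"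
        then have w: "w \<in> vecs E" and wu: "snorm E l (w - u) < \<delta>" by (auto simp: E.ball_at_def)
        have "snorm F k (T w - v) \<le> snorm F k (T w - T u) + snorm F k (T u - v)"
          using maps w u U by (intro F.snorm_triangle_diff) auto
        also have "snorm F k (T w - T u) \<le> C * snorm E l (w - u)"
          using le[OF E.diff_mem[OF w u]] diff[OF w u] by simp
        also have "C * snorm E l (w - u) < C * \<delta>" using wu C by simp
        also have "C * \<delta> + snorm F k (T u - v) = \<epsilon>" using C by (simp add: \<delta>_def)
        finally show "w \<in> T -` U \<inter> topspace (graded_topology E)"
          using w maps by (auto simp: U F.ball_at_def E.topspace_graded_topology)
      qed
      then show "\<exists>V. openin (graded_topology E) V \<and> u \<in> V \<and>
          V \<subseteq> T -` U \<inter> topspace (graded_topology E)"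
        using E.openin_ball[OF u l \<delta>] E.center_in_ball[OF u l \<delta>] by blast
    qed
  next
    show "T ` topspace (graded_topology E) \<subseteq>
        \<Union>{F.ball_at k x \<epsilon> | x k \<epsilon>. x \<in> vecs F \<and> 1 \<le> k \<and> 0 < \<epsilon>}"
      unfolding F.union_balls E.topspace_graded_topology by (rule maps)
  qed
qed

section \<open>Koethe spaces\<close>

lemma vecs_koethe_iff:
  "x \<in> vecs (koethe_space a) \<longleftrightarrow>
     x 0 = 0 \<and> (\<forall>k\<ge>1. (\<lambda>n. norm (x n) * a n k) summable_on {1..})"
  by (simp add: koethe_space_def)

lemma snorm_koethe: "snorm (koethe_space a) k x = (\<Sum>\<^sub>\<infinity>n\<in>{1..}. norm (x n) * a n k)"
  by (simp add: koethe_space_def)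

lemma smult_koethe: "smult (koethe_space a) c x = (\<lambda>n. c * x n)"
  by (simp add: koethe_space_def)

lemma koethe_matrix_nonneg: "koethe_matrix a \<Longrightarrow> 1 \<le> n \<Longrightarrow> 1 \<le> k \<Longrightarrow> 0 \<le> a n k"
  by (simp add: koethe_matrix_def)

lemma koethe_summable:
  "x \<in> vecs (koethe_space a) \<Longrightarrow> 1 \<le> k \<Longrightarrow> (\<lambda>n. norm (x n) * a n k) summable_on {1..}"
  by (simp add: vecs_koethe_iff)

lemma koethe_snorm_nonneg: 
  assumes "koethe_matrix a" "1 \<le> k" shows "0 \<le> snorm (koethe_space a) k x"
  unfolding snorm_koethe
  by (intro infsum_nonneg mult_nonneg_nonneg norm_ge_zero koethe_matrix_nonneg assms) simp

lemma koethe_diff: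
  fixes x y :: "nat \<Rightarrow> 'k::{real_normed_field,banach}"
  assumes a: "koethe_matrix a" and x: "x \<in> vecs (koethe_space a)" and y: "y \<in> vecs (koethe_space a)"
  shows "x - y \<in> vecs (koethe_space a)"
    and "1 \<le> k \<Longrightarrow> snorm (koethe_space a) k (x - y) \<le>
      snorm (koethe_space a) k x + snorm (koethe_space a) k y"
proof -
  have le: "norm ((x - y) n) * a n k \<le> norm (x n) * a n k + norm (y n) * a n k"
    if "n \<in> {1..}" "1 \<le> k" for n k
    using mult_right_mono[OF norm_triangle_ineq4[of "x n" "y n"] koethe_matrix_nonneg[OF a, of n k]] that
    by (simp add: distrib_right)
  have add: "(\<lambda>n. norm (x n) * a n k + norm (y n) * a n k) summable_on {1..}" if "1 \<le> k" for k
    by (intro summable_on_add koethe_summable x y that)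
  have sm: "(\<lambda>n. norm ((x - y) n) * a n k) summable_on {1..}" if k: "1 \<le> k" for k
    by (rule summable_on_comparison_test[OF add[OF k] le])
      (use k koethe_matrix_nonneg[OF a] in auto)
  have "(x - y) 0 = 0" using x y by (simp add: vecs_koethe_iff)
  then show "x - y \<in> vecs (koethe_space a)"
    unfolding vecs_koethe_iff using sm by blast
  assume k: "1 \<le> k"
  show "snorm (koethe_space a) k (x - y) \<le> snorm (koethe_space a) k x + snorm (koethe_space a) k y"
    unfolding snorm_koethe
      infsum_add[OF koethe_summable[OF x k] koethe_summable[OF y k], symmetric]
    by (rule infsum_mono[OF sm[OF k] add[OF k]]) (use le k in blast)
qed

lemma graded_seminormed_group_koethe:
  assumes a: "koethe_matrix a"
  shows "graded_seminormed_group
    (koethe_space a :: ('k::{real_normed_field,banach}, nat \<Rightarrow> 'k) graded_space)"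
proof
  fix x y z :: "nat \<Rightarrow> 'k" and k :: nat
  show "snorm (koethe_space a) k (x - y) = snorm (koethe_space a) k (y - x)"
    by (simp add: snorm_koethe norm_minus_commute)
  show "snorm (koethe_space a) k (x - z) \<le>
      snorm (koethe_space a) k (x - y) + snorm (koethe_space a) k (y - z)"
    if k: "1 \<le> k" and m: "x \<in> vecs (koethe_space a)" "y \<in> vecs (koethe_space a)"
      "z \<in> vecs (koethe_space a)"
  proof -
    have eq: "(x - y) - (z - y) = x - z" by simp
    have "snorm (koethe_space a) k (x - z) \<le>
        snorm (koethe_space a) k (x - y) + snorm (koethe_space a) k (z - y)"
      using koethe_diff(2)[OF a koethe_diff(1)[OF a m(1,2)] koethe_diff(1)[OF a m(3,2)] k]
      unfolding eq .
    also have "snorm (koethe_space a) k (z - y) = snorm (koethe_space a) k (y - z)"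
      by (simp add: snorm_koethe norm_minus_commute)
    finally show ?thesis .
  qed
  show "0 \<in> vecs (koethe_space a :: ('k, nat \<Rightarrow> 'k) graded_space)"
    by (simp add: vecs_koethe_iff)
  show "snorm (koethe_space a) k (0 :: nat \<Rightarrow> 'k) = 0"
    by (simp add: snorm_koethe)
  show "x - y \<in> vecs (koethe_space a)"
    if "x \<in> vecs (koethe_space a)" "y \<in> vecs (koethe_space a)"
    using that by (rule koethe_diff(1)[OF a])
  show "0 \<le> snorm (koethe_space a) k x" if "1 \<le> k"
    using that by (rule koethe_snorm_nonneg[OF a])
qed

lemma koethe_smult:
  fixes x :: "nat \<Rightarrow> 'k::{real_normed_field,banach}"
  assumes x: "x \<in> vecs (koethe_space a)"
  shows "smult (koethe_space a) c x \<in> vecs (koethe_space a)"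
    and "snorm (koethe_space a) k (smult (koethe_space a) c x) = norm c * snorm (koethe_space a) k x"
proof -
  have eq: "norm (smult (koethe_space a) c x n) * a n l = norm c * (norm (x n) * a n l)" for n l
    by (simp add: smult_koethe norm_mult)
  have "(\<lambda>n. norm (smult (koethe_space a) c x n) * a n l) summable_on {1..}" if "1 \<le> l" for l
    unfolding eq by (intro summable_on_cmult_right koethe_summable x that)
  then show "smult (koethe_space a) c x \<in> vecs (koethe_space a)"
    using x by (simp add: vecs_koethe_iff) (simp add: smult_koethe)
  show "snorm (koethe_space a) k (smult (koethe_space a) c x) = norm c * snorm (koethe_space a) k x"
    unfolding snorm_koethe eq by (rule infsum_cmult_right')
qed

lemma koethe_unit_seq:
  assumes "1 \<le> j"
  shows "(unit_seq j :: nat \<Rightarrow> 'k::{real_normed_field,banach}) \<in> vecs (koethe_space a)"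
    and "snorm (koethe_space a) k (unit_seq j :: nat \<Rightarrow> 'k) = a j k"
proof -
  have eq: "norm (unit_seq j n :: 'k) * a n l = (if n = j then a j l else 0)" for n l
    by (simp add: unit_seq_def)
  have "((\<lambda>n. if n = j then a j l else 0) has_sum a j l) {1..}" for l
    using assms by (intro has_sum_finite_neutralI[of "{j}"]) auto
  then have hs: "((\<lambda>n. norm (unit_seq j n :: 'k) * a n l) has_sum a j l) {1..}" for l
    unfolding eq .
  show "(unit_seq j :: nat \<Rightarrow> 'k) \<in> vecs (koethe_space a)"
    using has_sum_imp_summable[OF hs] assms unfolding vecs_koethe_iff by (simp add: unit_seq_def)
  show "snorm (koethe_space a) k (unit_seq j :: nat \<Rightarrow> 'k) = a j k"
    unfolding snorm_koethe by (rule infsumI[OF hs])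
qed

text \<open>
  Single seminorms may vanish on a coordinate; the condition that each row of a Koethe matrix has a
  positive entry provides one that does not.
\<close>

lemma koethe_separating:
  fixes x :: "nat \<Rightarrow> 'k::{real_normed_field,banach}"
  assumes a: "koethe_matrix a" and x: "x \<in> vecs (koethe_space a)"
    and 0: "\<And>k. 1 \<le> k \<Longrightarrow> snorm (koethe_space a) k x = 0"
  shows "x = 0"
proof
  fix n
  show "x n = 0 n"
  proof (cases "n = 0")
    case True
    then show ?thesis using x by (simp add: vecs_koethe_iff)
  next
    case False
    then have "1 \<le> n" by simp
    then obtain k where k: "1 \<le> k" "0 < a n k"
      using a unfolding koethe_matrix_def by blast
    have "norm (x n) * a n k = 0"
      using 0[OF k(1)] koethe_summable[OF x k(1)] koethe_matrix_nonneg[OF a _ k(1)] False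
      unfolding snorm_koethe by (intro nonneg_infsum_le_0D[where A = "{1..}"]) auto
    then show ?thesis using k by simp
  qed
qed

text \<open>
  The first index \<open>m\<close> of the series is arbitrary so that the bound applies to the tails as well.
  The reason for it is Tonelli's theorem for the double sum of \<open>norm (f n i) * a i k\<close>.
\<close>

lemma koethe_pointwise_sum:
  fixes f :: "nat \<Rightarrow> nat \<Rightarrow> 'k::{real_normed_field,banach}"
  assumes a: "koethe_matrix a"
    and f: "\<And>n. m \<le> n \<Longrightarrow> f n \<in> vecs (koethe_space a)"
    and abs: "\<And>k. 1 \<le> k \<Longrightarrow> (\<lambda>n. snorm (koethe_space a) k (f n)) summable_on {m..}"
  shows "\<And>i. (\<lambda>n. f n i) summable_on {m..}"
    and "(\<lambda>i. \<Sum>\<^sub>\<infinity>n\<in>{m..}. f n i) \<in> vecs (koethe_space a)"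
    and "1 \<le> k \<Longrightarrow> snorm (koethe_space a) k (\<lambda>i. \<Sum>\<^sub>\<infinity>n\<in>{m..}. f n i) \<le>
      (\<Sum>\<^sub>\<infinity>n\<in>{m..}. snorm (koethe_space a) k (f n))"
proof -
  let ?y = "\<lambda>i. \<Sum>\<^sub>\<infinity>n\<in>{m..}. f n i"
  have double: "(\<lambda>(n, i). norm (f n i) * a i k) summable_on {m..} \<times> {1..}" if k: "1 \<le> k" for k
  proof (rule summable_on_SigmaI[where g = "\<lambda>n. snorm (koethe_space a) k (f n)", OF _ abs[OF k]])
    show "((\<lambda>i. case (n, i) of (n, i) \<Rightarrow> norm (f n i) * a i k) has_sum
        snorm (koethe_space a) k (f n)) {1..}" if "n \<in> {m..}" for n
      using has_sum_infsum[OF koethe_summable[OF f k]] that by (simp add: snorm_koethe)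
  qed (use k koethe_matrix_nonneg[OF a] in auto)
  then have swapped: "(\<lambda>(i, n). norm (f n i) * a i k) summable_on {1..} \<times> {m..}" if "1 \<le> k" for k
    using summable_on_swap[of "\<lambda>(n, i). norm (f n i) * a i k" "{m..}" "{1..}"] that
    by (simp add: case_prod_unfold)
  have row: "(\<lambda>n. norm (f n i)) summable_on {m..}" if i: "1 \<le> i" for i
  proof -
    obtain k where k: "1 \<le> k" "0 < a i k" using a i unfolding koethe_matrix_def by blast
    have "(\<lambda>n. norm (f n i) * a i k) summable_on {m..}"
      using summable_on_SigmaD1[OF swapped[OF k(1)]] i koethe_matrix_nonneg[OF a _ k(1)] by auto
    then show ?thesis using summable_on_cmult_left'[of "a i k" "\<lambda>n. norm (f n i)"] k by simp
  qed
  show "(\<lambda>n. f n i) summable_on {m..}" for i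
  proof (cases "i = 0")
    case True
    then have "f n i = 0" if "m \<le> n" for n using f that by (simp add: vecs_koethe_iff)
    then show ?thesis by (intro summable_on_0) simp
  qed (simp add: abs_summable_summable row)
  define h where "h k i = (\<Sum>\<^sub>\<infinity>n\<in>{m..}. norm (f n i) * a i k)" for k i
  have h: "h k summable_on {1..}" if "1 \<le> k" for k
    unfolding h_def using summable_on_Sigma_banach[OF swapped[OF that]] by simp
  have le: "norm (?y i) * a i k \<le> h k i" if "i \<in> {1..}" "1 \<le> k" for i k
    unfolding h_def infsum_cmult_left'
    using norm_infsum_bound[OF row] koethe_matrix_nonneg[OF a] that by (intro mult_right_mono) auto
  have sm: "(\<lambda>i. norm (?y i) * a i k) summable_on {1..}" if k: "1 \<le> k" for k
    by (rule summable_on_comparison_test[OF h[OF k] le])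
      (use k koethe_matrix_nonneg[OF a] in auto)
  have "?y 0 = 0" using f by (intro infsum_0) (simp add: vecs_koethe_iff)
  then show "?y \<in> vecs (koethe_space a)" using sm by (simp add: vecs_koethe_iff)
  show "snorm (koethe_space a) k ?y \<le> (\<Sum>\<^sub>\<infinity>n\<in>{m..}. snorm (koethe_space a) k (f n))"
    if k: "1 \<le> k"
  proof -
    have "snorm (koethe_space a) k ?y \<le> infsum (h k) {1..}"
      unfolding snorm_koethe by (rule infsum_mono[OF sm[OF k] h[OF k]]) (use le k in blast)
    also have "\<dots> = (\<Sum>\<^sub>\<infinity>n\<in>{m..}. snorm (koethe_space a) k (f n))"
      unfolding snorm_koethe h_def using infsum_swap_banach[OF double[OF k]] by simp
    finally show ?thesis .
  qed
qed

lemma infsum_tail_tendsto_0: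
  fixes g :: "nat \<Rightarrow> real"
  assumes g: "g summable_on {m..}"
  shows "(\<lambda>N. infsum g {Suc N..}) \<longlonglongrightarrow> 0"
proof -
  have "filterlim (\<lambda>N. {m..N}) (finite_subsets_at_top {m..}) sequentially"
    unfolding filterlim_finite_subsets_at_top
  proof (intro allI impI)
    fix X assume X: "finite X \<and> X \<subseteq> {m..}"
    show "\<forall>\<^sub>F N in sequentially. finite {m..N} \<and> X \<subseteq> {m..N} \<and> {m..N} \<subseteq> {m..}"
      using eventually_ge_at_top[of "Max X"]
    proof eventually_elim
      case (elim N)
      then have "X \<subseteq> {..N}" using X by (auto intro: order_trans[OF Max_ge])
      then show ?case using X by auto
    qed
  qed
  from filterlim_compose[OF infsum_tendsto[OF g] this]
  have "(\<lambda>N. sum g {m..N}) \<longlonglongrightarrow> infsum g {m..}" .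
  from tendsto_diff[OF tendsto_const this]
  have "(\<lambda>N. infsum g {m..} - sum g {m..N}) \<longlonglongrightarrow> infsum g {m..} - infsum g {m..}" .
  then have "(\<lambda>N. infsum g {m..} - sum g {m..N}) \<longlonglongrightarrow> 0" by simp
  moreover have "\<forall>\<^sub>F N in sequentially. infsum g {m..} - sum g {m..N} = infsum g {Suc N..}"
    using eventually_ge_at_top[of m]
  proof eventually_elim
    case (elim N)
    then have split: "{m..N} \<union> {Suc N..} = {m..}" by auto
    have "g summable_on {Suc N..}"
      by (rule summable_on_subset[OF g]) (use elim in auto)
    then show ?case
      using infsum_Un_disjoint[of g "{m..N}" "{Suc N..}"] unfolding split by simp
  qed
  ultimately show ?thesis by (rule Lim_transform_eventually)
qed

lemma sum_functions_apply: "(\<Sum>j\<in>J. f j) i = (\<Sum>j\<in>J. f j i)"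
  for f :: "'j \<Rightarrow> 'i \<Rightarrow> 'a::comm_monoid_add"
  by (induction J rule: infinite_finite_induct) simp_all

text \<open>
  The difference between the coordinatewise sum and a partial sum is the coordinatewise sum of a
  tail, so its seminorm is at most a tail of a convergent series of real numbers.
\<close>

lemma koethe_absolutely_convergent_series:
  fixes f :: "nat \<Rightarrow> nat \<Rightarrow> 'k::{real_normed_field,banach}"
  assumes a: "koethe_matrix a"
    and f: "\<And>n. m \<le> n \<Longrightarrow> f n \<in> vecs (koethe_space a)"
    and abs: "\<And>k. 1 \<le> k \<Longrightarrow> (\<lambda>n. snorm (koethe_space a) k (f n)) summable_on {m..}"
  shows "graded_series (koethe_space a) m f = (\<lambda>i. \<Sum>\<^sub>\<infinity>n\<in>{m..}. f n i)" (is "_ = ?y")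
proof (rule graded_seminormed_group.graded_series_eqI[OF graded_seminormed_group_koethe[OF a]])
  show "?y \<in> vecs (koethe_space a)" by (rule koethe_pointwise_sum(2)[OF a f abs])
  fix k :: nat assume k: "1 \<le> k"
  let ?nm = "snorm (koethe_space a :: ('k, nat \<Rightarrow> 'k) graded_space) k"
  have tail: "?nm ((\<Sum>j=m..N. f j) - ?y) \<le> (\<Sum>\<^sub>\<infinity>n\<in>{Suc N..}. ?nm (f n))" if N: "m \<le> N" for N
  proof -
    have sub: "{Suc N..} \<subseteq> {m..}" using N by auto
    have abs': "(\<lambda>n. snorm (koethe_space a) k (f n)) summable_on {Suc N..}" if "1 \<le> k" for k
      by (rule summable_on_subset[OF abs[OF that] sub])
    have "?y i = (\<Sum>j=m..N. f j i) + (\<Sum>\<^sub>\<infinity>n\<in>{Suc N..}. f n i)" for i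
    proof -
      have split: "{m..N} \<union> {Suc N..} = {m..}" using N by auto
      have "(\<lambda>n. f n i) summable_on {Suc N..}"
        by (rule koethe_pointwise_sum(1)[OF a _ abs']) (use f N in auto)
      then show ?thesis
        using infsum_Un_disjoint[of "\<lambda>n. f n i" "{m..N}" "{Suc N..}"] unfolding split by simp
    qed
    then have "?y i - (\<Sum>j=m..N. f j) i = (\<Sum>\<^sub>\<infinity>n\<in>{Suc N..}. f n i)" for i
      unfolding sum_functions_apply by (simp add: algebra_simps)
    then have "?y - (\<Sum>j=m..N. f j) = (\<lambda>i. \<Sum>\<^sub>\<infinity>n\<in>{Suc N..}. f n i)"
      by (simp add: fun_eq_iff)
    then have "?nm ((\<Sum>j=m..N. f j) - ?y) = ?nm (\<lambda>i. \<Sum>\<^sub>\<infinity>n\<in>{Suc N..}. f n i)"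
      by (metis graded_seminormed_group.snorm_minus_commute graded_seminormed_group_koethe[OF a])
    also have "\<dots> \<le> (\<Sum>\<^sub>\<infinity>n\<in>{Suc N..}. ?nm (f n))"
      by (rule koethe_pointwise_sum(3)[OF a _ abs' k]) (use f N in auto)
    finally show ?thesis .
  qed
  show "(\<lambda>N. ?nm ((\<Sum>j=m..N. f j) - ?y)) \<longlonglongrightarrow> 0"
  proof (rule tendsto_sandwich[where f = "\<lambda>_. 0", OF _ _ tendsto_const infsum_tail_tendsto_0[OF abs[OF k]]])
    show "\<forall>\<^sub>F N in sequentially. 0 \<le> ?nm ((\<Sum>j=m..N. f j) - ?y)"
      by (intro always_eventually allI koethe_snorm_nonneg[OF a k])
    show "\<forall>\<^sub>F N in sequentially. ?nm ((\<Sum>j=m..N. f j) - ?y) \<le> (\<Sum>\<^sub>\<infinity>n\<in>{Suc N..}. ?nm (f n))"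
      using eventually_ge_at_top[of m] by eventually_elim (rule tail)
  qed
qed (use f koethe_separating[OF a] in auto)

section \<open>Toeplitz operators into a power series space of finite type\<close>

lemma koethe_matrix_finite_type:
  assumes "finite_type_weight \<beta>"
  shows "koethe_matrix (\<lambda>n k. exp (- (1 / real k) * \<beta> n))"
  unfolding koethe_matrix_def
  using assms by (auto simp: finite_type_weight_def intro!: exI[of _ "1::nat"] divide_left_mono)

text \<open>
  Half of the exponent pays for the symbol and the other half for the vector. This is where the
  factor 2 in \<open>S (2 k)\<close> comes from; the index is \<open>j - n + 1\<close> because coordinates start at 1 while
  symbols start at 0.
\<close>

lemma finite_type_weight_split:
  assumes \<beta>: "finite_type_weight \<beta>" and n: "1 \<le> n" "n \<le> j"
  shows "exp (- (1 / real k) * \<beta> j) \<le>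
    exp (- (1 / real (2 * k)) * \<beta> (j - n + 1)) * exp (- (1 / real (2 * k)) * \<beta> n)"
proof -
  have "\<beta> n \<le> \<beta> j" "\<beta> (j - n + 1) \<le> \<beta> j"
    using \<beta> n by (auto simp: finite_type_weight_def intro!: mono_onD[of "{1..}" \<beta>])
  then have "(1 / real (2 * k)) * (\<beta> (j - n + 1) + \<beta> n) \<le> (1 / real (2 * k)) * (2 * \<beta> j)"
    by (intro mult_left_mono) auto
  also have "(1 / real (2 * k)) * (2 * \<beta> j) = (1 / real k) * \<beta> j" by simp
  finally show ?thesis by (simp add: exp_add[symmetric] distrib_left add.commute)
qed

text \<open>
  The norms of the terms \<open>\<theta> (j - n) e_j\<close> are dominated by those of the symbol shifted by \<open>n - 1\<close>
  places, in the seminorm \<open>2 k\<close>.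
\<close>

lemma toeplitz_column_finite_type:
  fixes \<theta> :: "nat \<Rightarrow> 'k::{real_normed_field,banach}"
  defines "F \<equiv> \<lambda>\<beta>. power_series_space_finite \<beta> :: ('k, nat \<Rightarrow> 'k) graded_space"
  assumes \<beta>: "finite_type_weight \<beta>" and \<theta>: "symbol_seq \<theta> \<in> vecs (F \<beta>)" and n: "1 \<le> n"
  shows "toeplitz_column (F \<beta>) \<theta> n = (\<lambda>i. if n \<le> i then \<theta> (i - n) else 0)"
    and "toeplitz_column (F \<beta>) \<theta> n \<in> vecs (F \<beta>)"
    and "1 \<le> k \<Longrightarrow> snorm (F \<beta>) k (toeplitz_column (F \<beta>) \<theta> n) \<le>
      snorm (F \<beta>) (2 * k) (symbol_seq \<theta>) * exp (- (1 / real (2 * k)) * \<beta> n)"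
proof -
  define b where "b = (\<lambda>n k. exp (- (1 / real k) * \<beta> n))"
  have F: "F \<beta> = koethe_space b" by (simp add: F_def b_def power_series_space_finite_def)
  have b: "koethe_matrix b" unfolding b_def by (rule koethe_matrix_finite_type[OF \<beta>])
  have bij: "bij_betw (\<lambda>j. j - n + 1) {n..} {1..}"
    by (rule bij_betw_byWitness[where f' = "\<lambda>i. i + n - 1"]) auto
  define f where "f j = smult (koethe_space b) (\<theta> (j - n)) (unit_seq j)" for j
  have f: "f j \<in> vecs (koethe_space b)" if "n \<le> j" for j
    unfolding f_def using that n by (intro koethe_smult koethe_unit_seq) simp
  have nf: "snorm (koethe_space b) k (f j) = norm (\<theta> (j - n)) * b j k" if "n \<le> j" for j k
    unfolding f_def using that n by (simp add: koethe_smult koethe_unit_seq)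
  define g where "g k j = norm (symbol_seq \<theta> (j - n + 1)) * b (j - n + 1) (2 * k) * b n (2 * k)" for k j
  have g: "g k summable_on {n..}" if "1 \<le> k" for k
    unfolding g_def using koethe_summable[OF \<theta>[unfolded F], of "2 * k"] that
    by (intro summable_on_cmult_left
        summable_on_reindex_bij_betw[OF bij, of "\<lambda>i. norm (symbol_seq \<theta> i) * b i (2 * k)", THEN iffD2])
      simp
  have isum_g: "infsum (g k) {n..} = snorm (koethe_space b) (2 * k) (symbol_seq \<theta>) * b n (2 * k)" for k
    unfolding g_def snorm_koethe infsum_cmult_left'
    using infsum_reindex_bij_betw[OF bij, of "\<lambda>i. norm (symbol_seq \<theta> i) * b i (2 * k)"] by simp
  have le: "snorm (koethe_space b) k (f j) \<le> g k j" if "j \<in> {n..}" for j k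
    using mult_left_mono[OF finite_type_weight_split[OF \<beta> n, of j k], of "norm (\<theta> (j - n))"] that
    by (simp add: nf g_def symbol_seq_def mult.assoc) (simp add: b_def)
  have abs: "(\<lambda>j. snorm (koethe_space b) k (f j)) summable_on {n..}" if k: "1 \<le> k" for k
    by (rule summable_on_comparison_test[OF g[OF k] le]) (use k koethe_snorm_nonneg[OF b] in auto)
  have series: "toeplitz_column (F \<beta>) \<theta> n = (\<lambda>i. \<Sum>\<^sub>\<infinity>j\<in>{n..}. f j i)"
    unfolding toeplitz_column_def F f_def[symmetric]
    by (rule koethe_absolutely_convergent_series[OF b f abs])
  have "((\<lambda>j. f j i) has_sum (if n \<le> i then \<theta> (i - n) else 0)) {n..}" for i
    by (rule has_sum_finite_neutralI[of "{n..} \<inter> {i}"])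
      (auto simp: f_def smult_koethe unit_seq_def Int_insert_right)
  then show "toeplitz_column (F \<beta>) \<theta> n = (\<lambda>i. if n \<le> i then \<theta> (i - n) else 0)"
    unfolding series using infsumI by blast
  show "toeplitz_column (F \<beta>) \<theta> n \<in> vecs (F \<beta>)"
    unfolding series unfolding F by (rule koethe_pointwise_sum(2)[OF b f abs])
  assume k: "1 \<le> k"
  have "snorm (F \<beta>) k (toeplitz_column (F \<beta>) \<theta> n) \<le> (\<Sum>\<^sub>\<infinity>j\<in>{n..}. snorm (koethe_space b) k (f j))"
    unfolding series unfolding F by (rule koethe_pointwise_sum(3)[OF b f abs k])
  also have "\<dots> \<le> infsum (g k) {n..}"
    by (rule infsum_mono[OF abs[OF k] g[OF k] le])
  finally show "snorm (F \<beta>) k (toeplitz_column (F \<beta>) \<theta> n) \<le>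
      snorm (F \<beta>) (2 * k) (symbol_seq \<theta>) * exp (- (1 / real (2 * k)) * \<beta> n)"
    unfolding isum_g F by (simp add: b_def)
qed

text \<open>
  By the column bound, the \<open>n\<close>-th term of the series of columns has \<open>k\<close>-norm at most a constant
  times \<open>norm (x n) * exp (- \<beta> n / (2 k))\<close>, so summability of the latter is absolute convergence.
\<close>

lemma toeplitz_operator_finite_type:
  fixes \<theta> x :: "nat \<Rightarrow> 'k::{real_normed_field,banach}"
  defines "F \<equiv> \<lambda>\<beta>. power_series_space_finite \<beta> :: ('k, nat \<Rightarrow> 'k) graded_space"
  assumes \<beta>: "finite_type_weight \<beta>" and \<theta>: "symbol_seq \<theta> \<in> vecs (F \<beta>)"
    and x: "\<And>k. 1 \<le> k \<Longrightarrow>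
      (\<lambda>n. norm (x n) * exp (- (1 / real (2 * k)) * \<beta> n)) summable_on {1..}"
  shows "toeplitz_operator (F \<beta>) \<theta> x = (\<lambda>i. \<Sum>n=1..i. x n * \<theta> (i - n))"
    and "toeplitz_operator (F \<beta>) \<theta> x \<in> vecs (F \<beta>)"
    and "1 \<le> k \<Longrightarrow> snorm (F \<beta>) k (toeplitz_operator (F \<beta>) \<theta> x) \<le>
      snorm (F \<beta>) (2 * k) (symbol_seq \<theta>) *
        (\<Sum>\<^sub>\<infinity>n\<in>{1..}. norm (x n) * exp (- (1 / real (2 * k)) * \<beta> n))"
proof -
  note column = toeplitz_column_finite_type[OF \<beta> \<theta>[unfolded F_def], folded F_def]
  define b where "b = (\<lambda>n k. exp (- (1 / real k) * \<beta> n))"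
  have F: "F \<beta> = koethe_space b" by (simp add: F_def b_def power_series_space_finite_def)
  have b: "koethe_matrix b" unfolding b_def by (rule koethe_matrix_finite_type[OF \<beta>])
  define f where "f n = smult (koethe_space b) (x n) (toeplitz_column (F \<beta>) \<theta> n)" for n
  have f: "f n \<in> vecs (koethe_space b)" if "1 \<le> n" for n
    unfolding f_def using column(2)[OF that] unfolding F by (rule koethe_smult(1))
  define g where "g k n = snorm (F \<beta>) (2 * k) (symbol_seq \<theta>) *
    (norm (x n) * exp (- (1 / real (2 * k)) * \<beta> n))" for k n
  have g: "g k summable_on {1..}" if "1 \<le> k" for k
    unfolding g_def by (intro summable_on_cmult_right x that)
  have le: "snorm (koethe_space b) k (f n) \<le> g k n" if "n \<in> {1..}" "1 \<le> k" for n k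
    using mult_left_mono[OF column(3)[of n k], of "norm (x n)"] that column(2)[of n] F
    by (simp add: f_def g_def koethe_smult mult.left_commute)
  have abs: "(\<lambda>n. snorm (koethe_space b) k (f n)) summable_on {1..}" if k: "1 \<le> k" for k
    by (rule summable_on_comparison_test[OF g[OF k] le]) (use k koethe_snorm_nonneg[OF b] in auto)
  have series: "toeplitz_operator (F \<beta>) \<theta> x = (\<lambda>i. \<Sum>\<^sub>\<infinity>n\<in>{1..}. f n i)"
    unfolding toeplitz_operator_def f_def[unfolded F[symmetric], symmetric]
    unfolding F by (rule koethe_absolutely_convergent_series[OF b f abs])
  have "((\<lambda>n. f n i) has_sum (\<Sum>n=1..i. x n * \<theta> (i - n))) {1..}" for i
    by (rule has_sum_finite_neutralI[of "{1..i}"])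
      (auto simp: f_def smult_koethe column(1))
  then show "toeplitz_operator (F \<beta>) \<theta> x = (\<lambda>i. \<Sum>n=1..i. x n * \<theta> (i - n))"
    unfolding series using infsumI by blast
  show "toeplitz_operator (F \<beta>) \<theta> x \<in> vecs (F \<beta>)"
    unfolding series unfolding F by (rule koethe_pointwise_sum(2)[OF b f abs])
  assume k: "1 \<le> k"
  have "snorm (F \<beta>) k (toeplitz_operator (F \<beta>) \<theta> x) \<le> (\<Sum>\<^sub>\<infinity>n\<in>{1..}. snorm (koethe_space b) k (f n))"
    unfolding series unfolding F by (rule koethe_pointwise_sum(3)[OF b f abs k])
  also have "\<dots> \<le> infsum (g k) {1..}"
    by (rule infsum_mono[OF abs[OF k] g[OF k]]) (use le k in blast)
  also have "\<dots> = snorm (F \<beta>) (2 * k) (symbol_seq \<theta>) *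
      (\<Sum>\<^sub>\<infinity>n\<in>{1..}. norm (x n) * exp (- (1 / real (2 * k)) * \<beta> n))"
    unfolding g_def by (rule infsum_cmult_right')
  finally show "snorm (F \<beta>) k (toeplitz_operator (F \<beta>) \<theta> x) \<le> \<dots>" .
qed

lemma koethe_weighted_l1_bound:
  fixes a :: "nat \<Rightarrow> nat \<Rightarrow> real" and w :: "nat \<Rightarrow> real"
  assumes "1 \<le> l" and w: "\<And>n. 1 \<le> n \<Longrightarrow> 0 \<le> w n \<and> w n \<le> C * a n l"
    and x: "x \<in> vecs (koethe_space a)"
  shows "(\<lambda>n. norm (x n) * w n) summable_on {1..}"
    and "(\<Sum>\<^sub>\<infinity>n\<in>{1..}. norm (x n) * w n) \<le> C * snorm (koethe_space a) l x"
proof -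
  have le: "norm (x n) * w n \<le> C * (norm (x n) * a n l)" if "n \<in> {1..}" for n
    using mult_left_mono[of "w n" "C * a n l" "norm (x n)"] w that by (simp add: mult.left_commute)
  have sm: "(\<lambda>n. C * (norm (x n) * a n l)) summable_on {1..}"
    using assms by (intro summable_on_cmult_right koethe_summable)
  show 1: "(\<lambda>n. norm (x n) * w n) summable_on {1..}"
    by (rule summable_on_comparison_test[OF sm le]) (use w in auto)
  show "(\<Sum>\<^sub>\<infinity>n\<in>{1..}. norm (x n) * w n) \<le> C * snorm (koethe_space a) l x"
    unfolding snorm_koethe infsum_cmult_right'[symmetric] by (rule infsum_mono[OF 1 sm le])
qed

theorem proposition3p5:
  fixes a :: "nat \<Rightarrow> nat \<Rightarrow> real" and \<beta> :: "nat \<Rightarrow> real" and S :: "nat \<Rightarrow> nat"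
  assumes "koethe_matrix a"
    and "finite_type_weight \<beta>"
    and "nondecreasing_index_map S"
    and "\<forall>k\<ge>1. \<exists>C>0. \<forall>n\<ge>1. exp (- (1 / real k) * \<beta> n) \<le> C * a n (S k)"
  shows "tame_family (\<lambda>k. S (2 * k))
           (koethe_space a) (power_series_space_finite \<beta>)
           (toeplitz_family \<beta> :: ((nat \<Rightarrow> 'k::{real_normed_field,banach}) \<Rightarrow> nat \<Rightarrow> 'k) set)"
proof -
  let ?E = "koethe_space a :: ('k, nat \<Rightarrow> 'k) graded_space"
  let ?F = "power_series_space_finite \<beta> :: ('k, nat \<Rightarrow> 'k) graded_space"
  have E: "graded_seminormed_group ?E" by (rule graded_seminormed_group_koethe[OF assms(1)])
  have F: "graded_seminormed_group ?F"
    unfolding power_series_space_finite_def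
    by (rule graded_seminormed_group_koethe[OF koethe_matrix_finite_type[OF assms(2)]])
  have S1: "1 \<le> S (2 * k)" if "1 \<le> k" for k
    using assms(3) that by (auto simp: nondecreasing_index_map_def image_subset_iff)
  have S: "nondecreasing_index_map (\<lambda>k. S (2 * k))"
    using assms(3) S1 by (auto simp: nondecreasing_index_map_def mono_on_def)
  have "T \<in> continuous_linear_operators ?E ?F \<and>
      (\<forall>k\<ge>1. \<exists>C>0. \<forall>x\<in>vecs ?E. snorm ?F k (T x) \<le> C * snorm ?E (S (2 * k)) x)"
    if "T \<in> toeplitz_family \<beta>" for T :: "(nat \<Rightarrow> 'k) \<Rightarrow> nat \<Rightarrow> 'k"
  proof -
    obtain \<theta> where T: "T = toeplitz_operator ?F \<theta>" and \<theta>: "symbol_seq \<theta> \<in> vecs ?F"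
      using \<open>T \<in> toeplitz_family \<beta>\<close> by (auto simp: toeplitz_family_def)
    have hyp: "\<exists>C>0. \<forall>x\<in>vecs ?E.
        (\<lambda>n. norm (x n) * exp (- (1 / real (2 * k)) * \<beta> n)) summable_on {1..} \<and>
        (\<Sum>\<^sub>\<infinity>n\<in>{1..}. norm (x n) * exp (- (1 / real (2 * k)) * \<beta> n)) \<le> C * snorm ?E (S (2 * k)) x"
      if k: "1 \<le> k" for k
    proof -
      obtain C where C: "0 < C"
        "\<And>n. 1 \<le> n \<Longrightarrow> exp (- (1 / real (2 * k)) * \<beta> n) \<le> C * a n (S (2 * k))"
        using assms(4)[rule_format, of "2 * k"] k by auto
      show ?thesis
        using C koethe_weighted_l1_bound[OF S1[OF k], of "\<lambda>n. exp (- (1 / real (2 * k)) * \<beta> n)" C a]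
        by (intro exI[of _ C] conjI ballI) auto
    qed
    then have sm: "(\<lambda>n. norm (x n) * exp (- (1 / real (2 * k)) * \<beta> n)) summable_on {1..}"
      if "x \<in> vecs ?E" "1 \<le> k" for x k
      using that by blast
    note op = toeplitz_operator_finite_type[OF assms(2) \<theta> sm, folded T]
    have bound: "\<exists>C>0. \<forall>x\<in>vecs ?E. snorm ?F k (T x) \<le> C * snorm ?E (S (2 * k)) x"
      if k: "1 \<le> k" for k
    proof -
      obtain C where C: "0 < C" "\<And>x. x \<in> vecs ?E \<Longrightarrow>
          (\<Sum>\<^sub>\<infinity>n\<in>{1..}. norm (x n) * exp (- (1 / real (2 * k)) * \<beta> n)) \<le> C * snorm ?E (S (2 * k)) x"
        using hyp[OF k] by blast
      \<comment> \<open>The norm of the symbol is increased by 1 to keep the constant positive.\<close>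
      let ?M = "snorm ?F (2 * k) (symbol_seq \<theta>)"
      have M: "0 \<le> ?M" using graded_seminormed_group.snorm_nonneg[OF F _ \<theta>, of "2 * k"] k by simp
      have "snorm ?F k (T x) \<le> (?M + 1) * C * snorm ?E (S (2 * k)) x" if x: "x \<in> vecs ?E" for x
      proof -
        have "snorm ?F k (T x) \<le>
            ?M * (\<Sum>\<^sub>\<infinity>n\<in>{1..}. norm (x n) * exp (- (1 / real (2 * k)) * \<beta> n))"
          by (rule op(3)[OF x _ k])
        also have "\<dots> \<le> ?M * (C * snorm ?E (S (2 * k)) x)"
          by (rule mult_left_mono[OF C(2)[OF x] M])
        also have "\<dots> \<le> (?M + 1) * (C * snorm ?E (S (2 * k)) x)"
          using C(1) koethe_snorm_nonneg[OF assms(1) S1[OF k], of x]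
          by (intro mult_right_mono mult_nonneg_nonneg) auto
        finally show ?thesis by (simp add: mult.assoc)
      qed
      moreover have "0 < (?M + 1) * C" using M C(1) by simp
      ultimately show ?thesis by blast
    qed
    have maps: "T ` vecs ?E \<subseteq> vecs ?F" using op(2) by blast
    have apply_T: "T x = (\<lambda>i. \<Sum>n=1..i. x n * \<theta> (i - n))" if "x \<in> vecs ?E" for x
      using op(1)[OF that] by simp
    have add: "T (x + y) = T x + T y" if "x \<in> vecs ?E" "y \<in> vecs ?E" for x y
      using that graded_seminormed_group.add_mem[OF E that]
      by (simp add: apply_T fun_eq_iff distrib_right sum.distrib)
    have diff: "T (x - y) = T x - T y" if "x \<in> vecs ?E" "y \<in> vecs ?E" for x y
      using that graded_seminormed_group.diff_mem[OF E that]
      by (simp add: apply_T fun_eq_iff left_diff_distrib sum_subtractf)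
    have scale: "T (smult ?E c x) = smult ?F c (T x)" if "x \<in> vecs ?E" for c x
      using that koethe_smult(1)[OF that, of c]
      by (simp add: apply_T smult_koethe power_series_space_finite_def sum_distrib_left mult.assoc)
    have "continuous_map (graded_topology ?E) (graded_topology ?F) T"
    proof (rule continuous_map_graded_topologyI[OF E F maps])
      show "T (x - y) = T x - T y" if "x \<in> vecs ?E" "y \<in> vecs ?E" for x y
        using that by (rule diff)
      show "\<exists>l\<ge>1. \<exists>C>0. \<forall>x\<in>vecs ?E. snorm ?F k (T x) \<le> C * snorm ?E l x" if k: "1 \<le> k" for k
        using bound[OF k] S1[OF k] by blast
    qed
    then show ?thesis
      using maps add scale bound by (simp add: continuous_linear_operators_def)
  qed
  then show ?thesis using S unfolding tame_family_def by blast
qed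

end
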